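(* Let $1/4 < \theta \le 1/2$, $\epsilon > 0$ and $C > 0$. For real $X>0$ let $E(X)$ denote the set of $x \in [X, 2X]$ such that the interval $[x, x + x^{1-2\theta} \log^{5+\epsilon} x]$ contains no $(\theta, C)$-almost square. Then the Lebesgue measure of $E(X)$ is $o(X)$ as $X \to \infty$; that is, for sufficiently large $X$, the interval $[x, x + x^{1-2\theta}\log^{5+\epsilon} x]$ contains a $(\theta,C)$-almost square for almost all $x \in [X,2X]$.
   Context: For $0 \le \theta \le 1/2$ and $C > 0$, an integer $n$ is called a $(\theta, C)$-almost square if $n = ab$ for some integers $a, b$ lying in the interval $[n^{1/2} - C n^{\theta}, n^{1/2} + C n^{\theta}]$. The notation $f(X) = o(g(X))$ means $\lim_{X\to\infty} f(X)/g(X) = 0$. *)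

theory Defs
  imports "HOL-Analysis.Analysis"
begin

(* Since n^(1/2) only makes sense for n >= 0, negative n are excluded explicitly
   (powr takes junk values at negative bases). *)
definition almost_square :: "real \<Rightarrow> real \<Rightarrow> int \<Rightarrow> bool" where
  "almost_square \<theta> C n \<longleftrightarrow> n \<ge> 0 \<and>
     (\<exists>a b :: int. n = a * b \<and>
        real_of_int a \<in> {sqrt (real_of_int n) - C * real_of_int n powr \<theta> ..
                          sqrt (real_of_int n) + C * real_of_int n powr \<theta>} \<and>
        real_of_int b \<in> {sqrt (real_of_int n) - C * real_of_int n powr \<theta> ..
                          sqrt (real_of_int n) + C * real_of_int n powr \<theta>})"

(* For x < 1 the value ln x powr (5 + \<epsilon>) is junk; only large X matters below. *)
definition exceptional_set :: "real \<Rightarrow> real \<Rightarrow> real \<Rightarrow> real \<Rightarrow> real set" where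
  "exceptional_set \<theta> C \<epsilon> X =
     {x \<in> {X..2 * X}.
        \<not> (\<exists>n :: int. almost_square \<theta> C n \<and>
              real_of_int n \<in> {x .. x + x powr (1 - 2 * \<theta>) * ln x powr (5 + \<epsilon>)})}"

end

theory Submission
  imports Defs "HOL-Real_Asymp.Real_Asymp"
begin

text \<open>
  A second moment argument. On a block \<open>[Z, Z + T]\<close> with \<open>T\<close> of order \<open>X powr (1/2 + \<theta>)\<close>, use only the
  almost squares \<open>n = a * b\<close> whose factor \<open>a = g * q\<close> near \<open>sqrt Z\<close> is divisible by one fixed \<open>g\<close>
  of size about \<open>ln X * X powr (1/2 - \<theta>)\<close>. With \<open>y = \<lfloor>x / g\<rfloor>\<close> the question becomes whether one of the
  moduli \<open>q\<close>, of size about \<open>sqrt X / g\<close>, divides an integer in \<open>{y + 1..y + l}\<close>. By the choice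
  of \<open>g\<close> the relevant \<open>y\<close> run over an interval longer, by a factor of order \<open>ln X\<close>, than the joint
  period of any two moduli. So the hits have nearly independent counts, up to the gcds of the
  moduli, whose sum costs one logarithm; the mean is at least of order \<open>ln X ^ 4\<close>, and Chebyshev's
  inequality bounds the number of \<open>y\<close> without a hit.
\<close>

section \<open>Residue classes in an interval of integers\<close>

text \<open>The members are \<open>c + P * k\<close> with \<open>k\<close> between two ceilings, the
  ceilings of numbers that differ by exactly \<open>M / P\<close>.\<close>

lemma card_cong_interval:
  fixes a c P M :: int
  assumes "P > 0" "M \<ge> 0"
  shows "real (card {y \<in> {a..<a+M}. P dvd y - c}) \<le> M / P + 1"
    and "real (card {y \<in> {a..<a+M}. P dvd y - c}) \<ge> M / P - 1"
proof -
  define u v where "u = \<lceil>(a - c) / P\<rceil>" and "v = \<lceil>(a + M - c) / P\<rceil>"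
  have lo: "a \<le> c + P * k \<longleftrightarrow> u \<le> k" and hi: "c + P * k < a + M \<longleftrightarrow> k < v" for k
  proof -
    have "u \<le> k \<longleftrightarrow> (a - c) / P \<le> real_of_int k"
      unfolding u_def by (simp add: ceiling_le_iff)
    also have "\<dots> \<longleftrightarrow> real_of_int (a - c) \<le> real_of_int (P * k)"
      using assms by (simp add: divide_le_eq mult.commute)
    finally show "a \<le> c + P * k \<longleftrightarrow> u \<le> k" by linarith
    have "k < v \<longleftrightarrow> real_of_int k < (a + M - c) / P"
      unfolding v_def by (simp add: less_ceiling_iff)
    also have "\<dots> \<longleftrightarrow> real_of_int (P * k) < real_of_int (a + M - c)"
      using assms by (simp add: less_divide_eq mult.commute)
    finally show "c + P * k < a + M \<longleftrightarrow> k < v" by linarith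
  qed
  have "{y \<in> {a..<a+M}. P dvd y - c} = (\<lambda>k. c + P * k) ` {u..<v}"
  proof (intro equalityI subsetI)
    fix y assume "y \<in> {y \<in> {a..<a+M}. P dvd y - c}"
    then obtain k where "y - c = P * k" "y \<in> {a..<a+M}" by auto
    then have "y = c + P * k" "a \<le> c + P * k" "c + P * k < a + M" by auto
    then show "y \<in> (\<lambda>k. c + P * k) ` {u..<v}" using lo hi by auto
  next
    fix y assume "y \<in> (\<lambda>k. c + P * k) ` {u..<v}"
    then show "y \<in> {y \<in> {a..<a+M}. P dvd y - c}" using lo hi by auto
  qed
  moreover have "inj_on (\<lambda>k. c + P * k) {u..<v}"
    using assms by (auto simp: inj_on_def)
  ultimately have "card {y \<in> {a..<a+M}. P dvd y - c} = nat (v - u)"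
    by (simp add: card_image)
  moreover have "u \<le> v"
    unfolding u_def v_def using assms by (intro ceiling_mono divide_right_mono) auto
  ultimately have "real (card {y \<in> {a..<a+M}. P dvd y - c}) = real_of_int v - real_of_int u"
    by simp
  moreover have "(a + M - c) / P = (a - c) / P + M / real_of_int P"
    by (simp add: add_divide_distrib diff_divide_distrib)
  then have "real_of_int v - u \<le> M / P + 1" "real_of_int v - u \<ge> M / P - 1"
    unfolding u_def v_def by linarith+
  ultimately show "real (card {y \<in> {a..<a+M}. P dvd y - c}) \<le> M / P + 1"
    and "real (card {y \<in> {a..<a+M}. P dvd y - c}) \<ge> M / P - 1" by linarith+
qed

text \<open>A common solution \<open>c\<close> forces \<open>gcd q r dvd i - j\<close>, and every
  other solution is congruent to \<open>c\<close> modulo \<open>lcm q r\<close>. The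
  \<open>of_bool\<close> factor is kept because it is later summed over \<open>i\<close> and
  \<open>j\<close>.\<close>

lemma card_two_cong_interval:
  fixes a i j q r M :: int
  assumes "q > 0" "r > 0" "M \<ge> 0"
  shows "real (card {y \<in> {a..<a+M}. q dvd y + i \<and> r dvd y + j})
           \<le> of_bool (gcd q r dvd i - j) * (M * gcd q r / (q * r) + 1)"
proof (cases "{y \<in> {a..<a+M}. q dvd y + i \<and> r dvd y + j} = {}")
  case True
  then show ?thesis using assms by (simp only: card.empty) auto
next
  case False
  then obtain c where c: "q dvd c + i" "r dvd c + j" by blast
  then have "gcd q r dvd (c + i) - (c + j)" by (meson dvd_diff dvd_trans gcd_dvd1 gcd_dvd2)
  then have gd: "gcd q r dvd i - j" by simp
  have "q dvd y - c" "r dvd y - c" if "q dvd y + i" "r dvd y + j" for y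
    using dvd_diff[OF that(1) c(1)] dvd_diff[OF that(2) c(2)] by simp_all
  then have "{y \<in> {a..<a+M}. q dvd y + i \<and> r dvd y + j} \<subseteq> {y \<in> {a..<a+M}. lcm q r dvd y - c}"
    by (auto intro: lcm_least)
  then have "card {y \<in> {a..<a+M}. q dvd y + i \<and> r dvd y + j} \<le> card {y \<in> {a..<a+M}. lcm q r dvd y - c}"
    by (intro card_mono finite_subset[OF _ finite_atLeastLessThan_int[of a "a + M"]]) auto
  also have "real \<dots> \<le> M / lcm q r + 1"
    using assms by (intro card_cong_interval) (auto simp: lcm_pos_int)
  also have "M / real_of_int (lcm q r) = M * gcd q r / (q * r)"
  proof -
    have "gcd q r * lcm q r = q * r"
      using assms by (simp add: prod_gcd_lcm_int[symmetric])
    then have "real_of_int (q * r) = real_of_int (gcd q r) * real_of_int (lcm q r)"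
      by (metis of_int_mult)
    moreover have "gcd q r > 0" "lcm q r > 0" using assms by (auto simp: lcm_pos_int)
    ultimately show ?thesis by (simp add: field_simps)
  qed
  finally show ?thesis using gd by simp
qed

section \<open>Moments of the number of hits, and Chebyshev's inequality\<close>

text \<open>Pairs \<open>(q, i)\<close> are counted with multiplicity, so that moments reduce to
  counting congruences after swapping sums. The value is 0 exactly when no \<open>q\<close> in
  \<open>S\<close> divides an element of \<open>{y + 1..y + l}\<close>.\<close>

definition hits :: "int set \<Rightarrow> nat \<Rightarrow> int \<Rightarrow> real" where
  "hits S l y = (\<Sum>(q,i)\<in>S \<times> {1..int l}. of_bool (q dvd y + i))"

lemma sum_of_bool_interval:
  "(\<Sum>y\<in>{a..<b::int}. of_bool (Q y)) = real (card {y \<in> {a..<b}. Q y})"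
  by (simp add: Int_def flip: sum.inter_filter)

text \<open>Each pair \<open>(q, i)\<close> contributes at least \<open>M / q - 1\<close>, and
  \<open>q \<le> \<delta> * M\<close> makes the lost 1 at most
  \<open>\<delta> * M / q\<close>.\<close>

lemma sum_hits_ge:
  fixes S :: "int set" and \<delta> :: real and a M :: int and l :: nat
  assumes S: "finite S" "\<And>q. q \<in> S \<Longrightarrow> 0 < q" and M: "M \<ge> 0"
    and \<delta>: "\<And>q. q \<in> S \<Longrightarrow> q \<le> \<delta> * M"
  shows "(\<Sum>y\<in>{a..<a+M}. hits S l y) \<ge> (1 - \<delta>) * M * (\<Sum>q\<in>S. l / q)"
proof -
  have "(1 - \<delta>) * M * (\<Sum>q\<in>S. l / q) = (\<Sum>(q,i)\<in>S \<times> {1..int l}. (1 - \<delta>) * M / q)"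
    by (simp add: sum.cartesian_product[symmetric] sum_distrib_left mult_ac)
  also have "\<dots> \<le> (\<Sum>(q,i)\<in>S \<times> {1..int l}. \<Sum>y\<in>{a..<a+M}. of_bool (q dvd y + i))"
  proof (intro sum_mono, clarify)
    fix q i assume "q \<in> S"
    then have q: "q > 0" "q \<le> \<delta> * M" using S \<delta> by auto
    have "(1 - \<delta>) * M / q \<le> M / q - 1"
      using q by (simp add: field_simps)
    also have "\<dots> \<le> real (card {y \<in> {a..<a+M}. q dvd y - (-i)})"
      using q M by (intro card_cong_interval) auto
    finally show "(1 - \<delta>) * M / q \<le> (\<Sum>y\<in>{a..<a+M}. of_bool (q dvd y + i))"
      by (simp only: sum_of_bool_interval) simp
  qed
  also have "\<dots> = (\<Sum>y\<in>{a..<a+M}. hits S l y)"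
    unfolding hits_def by (subst sum.swap) (simp add: case_prod_unfold)
  finally show ?thesis .
qed

text \<open>Expanding the square gives pairs of congruences. Since
  \<open>q * r \<le> \<delta> * M\<close>, the rounding error 1 in each count is absorbed into the
  factor \<open>1 + \<delta>\<close>. With \<open>d = gcd q r\<close>, at most
  \<open>l * (l / d + 1)\<close> pairs of offsets are compatible; times \<open>d / (q * r)\<close>
  this is the product of the means \<open>l / q\<close> and \<open>l / r\<close> plus the
  correlation \<open>l * d / (q * r)\<close>.\<close>

lemma sum_hits_square_le:
  fixes S :: "int set" and \<delta> :: real and a M :: int and l :: nat
  assumes S: "finite S" "\<And>q. q \<in> S \<Longrightarrow> 0 < q" and M: "M \<ge> 0"
    and \<delta>: "\<delta> \<ge> 0" "\<And>q r. q \<in> S \<Longrightarrow> r \<in> S \<Longrightarrow> q * r \<le> \<delta> * M"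
  shows "(\<Sum>y\<in>{a..<a+M}. (hits S l y)\<^sup>2)
           \<le> (1 + \<delta>) * M * ((\<Sum>q\<in>S. l / q)\<^sup>2 + l * (\<Sum>q\<in>S. \<Sum>r\<in>S. gcd q r / (q * r)))"
proof -
  let ?I = "{1..int l}"
  have ij: "(\<Sum>i\<in>?I. \<Sum>j\<in>?I. of_bool (d dvd i - j)) \<le> l * (real l / d + 1)" if "d > 0" for d :: int
  proof -
    have "(\<Sum>j\<in>?I. of_bool (d dvd i - j)) \<le> real l / d + 1" for i
    proof -
      have "(\<Sum>j\<in>?I. of_bool (d dvd i - j)) = real (card {y \<in> {1..<1 + int l}. d dvd y - i})"
        by (subst sum_of_bool_interval[symmetric])
          (rule sum.cong, auto simp: dvd_diff_commute)
      also have "\<dots> \<le> real_of_int (int l) / d + 1"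
        by (intro card_cong_interval) (use that in auto)
      finally show ?thesis by simp
    qed
    then have "(\<Sum>i\<in>?I. \<Sum>j\<in>?I. of_bool (d dvd i - j)) \<le> (\<Sum>i\<in>?I. real l / d + 1)"
      by (intro sum_mono)
    then show ?thesis by simp
  qed
  have "(hits S l y)\<^sup>2
      = (\<Sum>q\<in>S. \<Sum>r\<in>S. \<Sum>i\<in>?I. \<Sum>j\<in>?I. of_bool (q dvd y + i \<and> r dvd y + j))" for y
    unfolding hits_def power2_eq_square sum.cartesian_product[symmetric] sum_product of_bool_conj ..
  then have "(\<Sum>y\<in>{a..<a+M}. (hits S l y)\<^sup>2)
      = (\<Sum>q\<in>S. \<Sum>r\<in>S. \<Sum>i\<in>?I. \<Sum>j\<in>?I. \<Sum>y\<in>{a..<a+M}. of_bool (q dvd y + i \<and> r dvd y + j))"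
    by (simp only: sum.swap[of _ S "{a..<a+M}"] sum.swap[of _ ?I "{a..<a+M}"])
  also have "\<dots> \<le> (\<Sum>q\<in>S. \<Sum>r\<in>S. (1 + \<delta>) * M * (real l / q * (l / r) + l * (gcd q r / (q * r))))"
  proof (intro sum_mono)
    fix q r assume "q \<in> S" "r \<in> S"
    then have qr: "q > 0" "r > 0" "q * r \<le> \<delta> * M" using S \<delta> by auto
    have d: "gcd q r > 0" using qr by simp
    have "1 \<le> \<delta> * M * gcd q r / (q * r)"
    proof -
      have "real_of_int (q * r) * 1 \<le> \<delta> * M * gcd q r"
        using qr d \<delta>(1) M by (intro mult_mono) (simp_all add: int_one_le_iff_zero_less)
      then show ?thesis using qr by (simp add: le_divide_eq)
    qed
    then have *: "M * gcd q r / (q * r) + 1 \<le> (1 + \<delta>) * M * gcd q r / (q * r)"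
      by (simp add: algebra_simps add_divide_distrib)
    have "(\<Sum>y\<in>{a..<a+M}. of_bool (q dvd y + i \<and> r dvd y + j))
        \<le> of_bool (gcd q r dvd i - j) * ((1 + \<delta>) * M * gcd q r / (q * r))" for i j
    proof -
      have "(\<Sum>y\<in>{a..<a+M}. of_bool (q dvd y + i \<and> r dvd y + j))
          \<le> of_bool (gcd q r dvd i - j) * (M * gcd q r / (q * r) + 1)"
        unfolding sum_of_bool_interval by (rule card_two_cong_interval[OF qr(1,2) M])
      also have "\<dots> \<le> of_bool (gcd q r dvd i - j) * ((1 + \<delta>) * M * gcd q r / (q * r))"
        using * by (intro mult_left_mono) simp_all
      finally show ?thesis .
    qed
    then have "(\<Sum>i\<in>?I. \<Sum>j\<in>?I. \<Sum>y\<in>{a..<a+M}. of_bool (q dvd y + i \<and> r dvd y + j))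
        \<le> (\<Sum>i\<in>?I. \<Sum>j\<in>?I. of_bool (gcd q r dvd i - j) * ((1 + \<delta>) * M * gcd q r / (q * r)))"
      by (intro sum_mono)
    also have "\<dots> = (\<Sum>i\<in>?I. \<Sum>j\<in>?I. of_bool (gcd q r dvd i - j)) * ((1 + \<delta>) * M * gcd q r / (q * r))"
      by (simp only: sum_distrib_right)
    also have "\<dots> \<le> (l * (real l / gcd q r + 1)) * ((1 + \<delta>) * M * gcd q r / (q * r))"
      using ij[OF d] qr d M \<delta> by (intro mult_right_mono) auto
    also have "\<dots> = (1 + \<delta>) * M * (real l / q * (l / r) + l * (gcd q r / (q * r)))"
      using qr d by (simp add: field_simps)
    finally show "(\<Sum>i\<in>?I. \<Sum>j\<in>?I. \<Sum>y\<in>{a..<a+M}. of_bool (q dvd y + i \<and> r dvd y + j)) \<le> \<dots>" .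
  qed
  also have "\<dots> = (1 + \<delta>) * M * ((\<Sum>q\<in>S. l / q)\<^sup>2 + l * (\<Sum>q\<in>S. \<Sum>r\<in>S. gcd q r / (q * r)))"
    unfolding power2_eq_square sum_product by (simp only: sum_distrib_left sum.distrib distrib_left)
  finally show ?thesis .
qed

text \<open>Chebyshev's inequality around the approximate mean \<open>E\<close>: each
  \<open>y\<close> without a hit contributes exactly \<open>E^2\<close> to the sum of
  \<open>(hits S l y - E)^2\<close>, which the two moment bounds control.\<close>

lemma card_no_hits_le:
  fixes S :: "int set" and E \<delta> :: real and a M :: int and l :: nat
  defines "E \<equiv> (\<Sum>q\<in>S. real l / real_of_int q)"
  assumes S: "finite S" "\<And>q. q \<in> S \<Longrightarrow> 0 < q" and M: "M \<ge> 0"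
    and \<delta>: "0 \<le> \<delta>" "\<delta> \<le> 1" "\<And>q r. q \<in> S \<Longrightarrow> r \<in> S \<Longrightarrow> q * r \<le> \<delta> * M"
  shows "card {y \<in> {a..<a+M}. \<forall>q\<in>S. \<forall>i\<in>{1..int l}. \<not> q dvd y + i} * E\<^sup>2
           \<le> M * (3 * \<delta> * E\<^sup>2 + 2 * l * (\<Sum>q\<in>S. \<Sum>r\<in>S. gcd q r / (q * r)))"
proof -
  let ?B = "{y \<in> {a..<a+M}. \<forall>q\<in>S. \<forall>i\<in>{1..int l}. \<not> q dvd y + i}"
  define G where "G = l * (\<Sum>q\<in>S. \<Sum>r\<in>S. gcd q r / (q * r))"
  have E: "E \<ge> 0" unfolding E_def using S(2) by (intro sum_nonneg) (force intro: divide_nonneg_pos)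
  have G: "G \<ge> 0" unfolding G_def using S(2)
    by (intro mult_nonneg_nonneg sum_nonneg divide_nonneg_pos) (auto intro: mult_pos_pos)
  \<comment> \<open>The hypothesis on products, taken with \<open>r = q\<close>, gives this because
    \<open>q \<ge> 1\<close>.\<close>
  have "q \<le> \<delta> * M" if "q \<in> S" for q
  proof -
    have "real_of_int q * 1 \<le> real_of_int q * q"
      using S(2)[OF that] by (intro mult_left_mono) auto
    then show ?thesis using \<delta>(3)[OF that that] by simp
  qed
  then have 1: "(\<Sum>y\<in>{a..<a+M}. hits S l y) \<ge> (1 - \<delta>) * M * E"
    unfolding E_def by (intro sum_hits_ge) (use S M in auto)
  have 2: "(\<Sum>y\<in>{a..<a+M}. (hits S l y)\<^sup>2) \<le> (1 + \<delta>) * M * (E\<^sup>2 + G)"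
    unfolding E_def G_def by (intro sum_hits_square_le) (use S M \<delta> in auto)
  have "card ?B * E\<^sup>2 = (\<Sum>y\<in>?B. (hits S l y - E)\<^sup>2)"
    by (simp add: hits_def sum.neutral)
  also have "\<dots> \<le> (\<Sum>y\<in>{a..<a+M}. (hits S l y - E)\<^sup>2)"
    by (intro sum_mono2) auto
  also have "\<dots> = (\<Sum>y\<in>{a..<a+M}. (hits S l y)\<^sup>2) - 2 * E * (\<Sum>y\<in>{a..<a+M}. hits S l y) + M * E\<^sup>2"
    using M by (simp add: power2_diff sum.distrib sum_subtractf sum_distrib_left mult_ac)
  also have "\<dots> \<le> (1 + \<delta>) * M * (E\<^sup>2 + G) - 2 * E * ((1 - \<delta>) * M * E) + M * E\<^sup>2"
    using 2 mult_left_mono[OF 1, of "2 * E"] E by simp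
  \<comment> \<open>The coefficients of \<open>M * E^2\<close> nearly cancel:
    \<open>(1 + \<delta>) - 2 * (1 - \<delta>) + 1 = 3 * \<delta>\<close>.\<close>
  also have "\<dots> = M * (3 * \<delta> * E\<^sup>2) + (1 + \<delta>) * (M * G)"
    by (simp add: algebra_simps power2_eq_square)
  also have "(1 + \<delta>) * (M * G) \<le> 2 * (M * G)"
    using \<delta> M G by (intro mult_right_mono) auto
  finally show ?thesis unfolding G_def by (simp add: algebra_simps)
qed

section \<open>The gcd sum over a short interval of moduli\<close>

text \<open>The diagonal gives \<open>R / B\<close>. For \<open>q \<noteq> r\<close> the gcd divides
  \<open>q - r\<close>, hence is below \<open>R\<close>, and is bounded by the sum of all common
  divisors \<open>d \<le> R\<close>. This overcounts, but for each \<open>d\<close> the sums over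
  \<open>q\<close> and \<open>r\<close> separate. Each \<open>d\<close> has at most
  \<open>2 * R / d\<close> multiples in the interval, so the total is harmonic and costs one
  logarithm.\<close>

lemma sum_gcd_le:
  fixes B :: int and R :: nat
  assumes "B > 0" "R > 0"
  shows "(\<Sum>q\<in>{B..<B+R}. \<Sum>r\<in>{B..<B+R}. gcd q r / (q * r))
           \<le> R / B + 4 * R\<^sup>2 * (1 + ln R) / B\<^sup>2"
proof -
  let ?S = "{B..<B+R}"
  have gcd_le: "gcd q r / (q * r) \<le> of_bool (q = r) / B
      + (\<Sum>d\<in>{1..R}. real d * of_bool (int d dvd q) * of_bool (int d dvd r)) / B\<^sup>2"
    if q: "q \<in> ?S" and r: "r \<in> ?S" for q r
  proof (cases "q = r")
    case True
    have "gcd q r / (q * r) = 1 / real_of_int q" using True q assms by auto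
    also have "\<dots> \<le> 1 / B" using q assms by (intro divide_left_mono) auto
    finally show ?thesis using True by (auto intro!: add_increasing2 divide_nonneg_nonneg sum_nonneg)
  next
    case False
    define d where "d = nat (gcd q r)"
    have "gcd q r dvd q - r" by simp
    then have "gcd q r \<le> \<bar>q - r\<bar>" using False dvd_imp_le_int[of "q - r" "gcd q r"] by simp
    moreover have "\<bar>q - r\<bar> < int R" using q r by auto
    moreover have "gcd q r \<ge> 1" using q assms by (simp add: int_one_le_iff_zero_less)
    ultimately have d: "d \<in> {1..R}" "int d = gcd q r" unfolding d_def by (simp_all add: le_nat_iff nat_le_iff)
    have "real_of_int (gcd q r) = real d * of_bool (int d dvd q) * of_bool (int d dvd r)"
      using d by simp
    also have "\<dots> \<le> (\<Sum>d\<in>{1..R}. real d * of_bool (int d dvd q) * of_bool (int d dvd r))"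
      using d(1) by (intro member_le_sum) auto
    finally have "gcd q r / (q * r) \<le> (\<Sum>d\<in>{1..R}. real d * of_bool (int d dvd q) * of_bool (int d dvd r)) / B\<^sup>2"
      using q r assms by (intro frac_le) (auto simp: power2_eq_square intro!: mult_mono sum_nonneg)
    then show ?thesis using False by simp
  qed
  have mult_le: "(\<Sum>q\<in>?S. of_bool (int d dvd q)) \<le> 2 * R / d" if "d \<in> {1..R}" for d
  proof -
    have "(\<Sum>q\<in>?S. of_bool (int d dvd q)) = real (card {q \<in> ?S. int d dvd q - 0})"
      by (simp only: sum_of_bool_interval) simp
    also have "\<dots> \<le> real_of_int (int R) / real_of_int (int d) + 1"
      using that by (intro card_cong_interval) auto
    \<comment> \<open>As \<open>d \<le> R\<close>, the rounding error 1 is at most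
      \<open>R / d\<close>.\<close>
    also have "\<dots> \<le> 2 * R / d" using that by (simp add: field_simps)
    finally show ?thesis .
  qed
  have "(\<Sum>q\<in>?S. \<Sum>r\<in>?S. gcd q r / (q * r)) \<le> (\<Sum>q\<in>?S. \<Sum>r\<in>?S. of_bool (q = r) / B
      + (\<Sum>d\<in>{1..R}. real d * of_bool (int d dvd q) * of_bool (int d dvd r)) / B\<^sup>2)"
    by (intro sum_mono) (use gcd_le in \<open>simp only: of_int_power of_int_mult\<close>)
  also have "\<dots> = (\<Sum>q\<in>?S. \<Sum>r\<in>?S. of_bool (q = r) / B)
      + (\<Sum>q\<in>?S. \<Sum>r\<in>?S. \<Sum>d\<in>{1..R}. real d * of_bool (int d dvd q) * of_bool (int d dvd r)) / B\<^sup>2"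
    by (simp only: sum.distrib sum_divide_distrib)
  also have "(\<Sum>q\<in>?S. \<Sum>r\<in>?S. of_bool (q = r) / real_of_int B) = R / B"
    by (simp add: sum_divide_distrib[symmetric] of_bool_def sum.delta)
  also have "(\<Sum>q\<in>?S. \<Sum>r\<in>?S. \<Sum>d\<in>{1..R}. real d * of_bool (int d dvd q) * of_bool (int d dvd r))
      = (\<Sum>d\<in>{1..R}. real d * ((\<Sum>q\<in>?S. of_bool (int d dvd q)) * (\<Sum>r\<in>?S. of_bool (int d dvd r))))"
    unfolding sum_product unfolding sum_distrib_left mult.assoc by (simp only: sum.swap[of _ "{1..R}" ?S])
  also have "\<dots> \<le> (\<Sum>d\<in>{1..R}. real d * ((2 * R / d) * (2 * R / d)))"
    by (intro sum_mono mult_left_mono mult_mono mult_le) (auto intro!: sum_nonneg)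
  also have "\<dots> = 4 * R\<^sup>2 * harm R"
    unfolding harm_def sum_distrib_left
    by (intro sum.cong) (auto simp: field_simps power2_eq_square)
  \<comment> \<open>The sequence \<open>harm n - ln n\<close> decreases from its value 1 at
    \<open>n = 1\<close>.\<close>
  also have "harm R \<le> 1 + ln (real R)"
    using euler_mascheroni_sequence_decreasing[of 1 R] assms by (simp add: harm_def)
  finally show ?thesis
    by (simp add: divide_right_mono mult_left_mono)
qed

section \<open>From divisibility to almost squares\<close>

text \<open>One factor close to \<open>sqrt n\<close> forces the other to be close, since
  \<open>a * (b - sqrt n) = sqrt n * (sqrt n - a)\<close>. With \<open>sqrt n \<le> 2 * a\<close>
  the deviation at most doubles, which is why \<open>a\<close> is only allowed
  \<open>C / 2\<close>.\<close>

lemma almost_squareI: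
  fixes a b n :: int and X \<theta> C :: real
  assumes n: "n = a * b" "X \<le> n" and X: "X > 0" and \<theta>: "\<theta> \<ge> 0" and C: "C > 0"
    and a: "\<bar>a - sqrt n\<bar> \<le> C / 2 * X powr \<theta>" "sqrt n \<le> 2 * a"
  shows "almost_square \<theta> C n"
proof -
  have npos: "real_of_int n > 0" using n X by linarith
  then have s: "sqrt n > 0" by simp
  then have apos: "real_of_int a > 0" using a by linarith
  have Xn: "C * X powr \<theta> \<le> C * real_of_int n powr \<theta>"
    using n X \<theta> C by (intro mult_left_mono powr_mono2) auto
  have "C * X powr \<theta> \<ge> 0" using C by simp
  with a Xn have 1: "\<bar>a - sqrt n\<bar> \<le> C * real_of_int n powr \<theta>" by linarith
  have "a * b = sqrt n * sqrt n" using n npos by simp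
  then have "a * (b - sqrt n) = sqrt n * (sqrt n - a)" by (simp add: algebra_simps)
  then have "a * \<bar>b - sqrt n\<bar> = sqrt n * \<bar>a - sqrt n\<bar>"
    using apos s by (metis abs_minus_commute abs_mult abs_of_pos)
  also have "\<dots> \<le> (2 * a) * (C / 2 * X powr \<theta>)"
    using a s apos by (intro mult_mono) auto
  finally have "\<bar>b - sqrt n\<bar> \<le> C * X powr \<theta>" using apos by (simp add: field_simps)
  with Xn have 2: "\<bar>b - sqrt n\<bar> \<le> C * real_of_int n powr \<theta>" by linarith
  from 1 2 show ?thesis
    unfolding almost_square_def atLeastAtMost_iff using npos n(1)
    by (intro conjI exI[of _ a] exI[of _ b]) linarith+
qed

text \<open>For \<open>y = \<lfloor>x / g\<rfloor>\<close> and a hit \<open>q dvd y + i\<close>, the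
  number \<open>n = g * (y + i)\<close> has the factor \<open>g * q\<close> near
  \<open>sqrt Z\<close> and exceeds \<open>x\<close> by at most \<open>g * l\<close>. It is then an
  almost square in the interval at \<open>x\<close>, so an exceptional \<open>x\<close> lies in a
  cell \<open>{g * y..g * (y + 1)}\<close> with \<open>y\<close> in \<open>Bad\<close>.\<close>

lemma exceptional_set_block_subset:
  fixes X Z T c \<theta> \<epsilon> C :: real and g B M :: int and R l :: nat
  defines "Bad \<equiv> {y \<in> {\<lfloor>Z / g\<rfloor>..<\<lfloor>Z / g\<rfloor> + M}. \<forall>q\<in>{B..<B+R}. \<forall>i\<in>{1..int l}. \<not> q dvd y + i}"
  assumes X: "X \<ge> 1" "X \<le> Z" and \<theta>: "0 \<le> \<theta>" "\<theta> \<le> 1/2" and C: "C > 0"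
    and c: "0 < c" "c \<le> C / 2" "c \<le> 1 / 4" and g: "g > 0"
    and M: "T / g + 1 \<le> M"
    and T: "T + g * l \<le> 2 * c * sqrt X * X powr \<theta>"
    and B: "sqrt Z \<le> g * B" "g * (B + R - 1) \<le> sqrt Z + c * X powr \<theta>"
    and l: "\<And>x. x \<ge> X \<Longrightarrow> g * l \<le> x powr (1 - 2 * \<theta>) * ln x powr (5 + \<epsilon>)"
  shows "exceptional_set \<theta> C \<epsilon> X \<inter> {Z..Z+T} \<subseteq> (\<Union>y\<in>Bad. {g * y..g * (y + 1)})"
proof
  fix x assume x: "x \<in> exceptional_set \<theta> C \<epsilon> X \<inter> {Z..Z+T}"
  define y where "y = \<lfloor>x / g\<rfloor>"
  have g': "real_of_int g > 0" using g by simp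
  have "y \<le> x / g" "x / g < y + 1" unfolding y_def by linarith+
  then have y: "g * y \<le> x" "x < g * (y + 1)" using g' by (simp_all add: field_simps)
  have "\<lfloor>Z / g\<rfloor> \<le> y" unfolding y_def using x g' by (intro floor_mono divide_right_mono) auto
  moreover have "y < \<lfloor>Z / g\<rfloor> + M"
  proof -
    have "x / g \<le> Z / g + T / g"
      using x g' by (simp flip: add_divide_distrib add: divide_right_mono)
    then have "x / g < \<lfloor>Z / g\<rfloor> + M" using M by linarith
    then show ?thesis unfolding y_def by linarith
  qed
  moreover have "\<not> q dvd y + i" if q: "q \<in> {B..<B+R}" and i: "i \<in> {1..int l}" for q i
  proof
    assume "q dvd y + i"
    then obtain k where k: "y + i = q * k" by auto
    define n where "n = g * (y + i)"
    have n: "n = g * q * k" unfolding n_def k by simp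
    \<comment> \<open>Offsets start at \<open>i = 1\<close>, so that \<open>n\<close> is not below
      \<open>x\<close>.\<close>
    have "g * (y + 1) \<le> n" "n \<le> g * y + g * l"
      unfolding n_def distrib_left[symmetric] using g i by (auto intro!: mult_left_mono)
    then have "real_of_int (g * (y + 1)) \<le> n" "n \<le> real_of_int (g * y + g * l)"
      by (simp_all only: of_int_le_iff)
    with y have nx: "x \<le> n" "n \<le> x + g * l" by auto
    have xX: "X \<le> x" "x \<le> 2 * X" and xZ: "Z \<le> x" "x \<le> Z + T" using x by (auto simp: exceptional_set_def)
    have P: "c * X powr \<theta> \<ge> 0" using c by simp
    have "X powr \<theta> \<le> X powr (1/2)" using X \<theta> by (intro powr_mono) auto
    then have Xs: "X powr \<theta> \<le> sqrt X" using X by (simp add: powr_half_sqrt)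
    have sXZ: "sqrt X \<le> sqrt Z" "sqrt X > 0" using X by auto
    have s1: "sqrt Z \<le> sqrt n" using nx xZ by simp
    \<comment> \<open>The bound on \<open>T + g * l\<close> is chosen as the cross term of a square,
      so that \<open>n\<close> stays below \<open>(sqrt Z + c * X powr \<theta>)^2\<close>.\<close>
    have "real_of_int n \<le> Z + 2 * (c * X powr \<theta>) * sqrt X"
      using nx xZ T by (simp add: mult_ac)
    also have "\<dots> \<le> (sqrt Z)\<^sup>2 + 2 * (c * X powr \<theta>) * sqrt Z + (c * X powr \<theta>)\<^sup>2"
      using P sXZ X by (auto intro!: add_increasing2 mult_left_mono)
    also have "\<dots> = (sqrt Z + c * X powr \<theta>)\<^sup>2" by (simp add: power2_sum)
    finally have s2: "sqrt n \<le> sqrt Z + c * X powr \<theta>"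
      using P sXZ by (intro real_le_lsqrt) auto
    have "g * B \<le> g * q" "g * q \<le> g * (B + R - 1)" using q g by (auto intro!: mult_left_mono)
    then have "real_of_int (g * B) \<le> real_of_int (g * q)" "real_of_int (g * q) \<le> real_of_int (g * (B + R - 1))"
      by (simp_all only: of_int_le_iff)
    with B have a: "sqrt Z \<le> g * q" "g * q \<le> sqrt Z + c * X powr \<theta>" by auto
    \<comment> \<open>Both \<open>g * q\<close> and \<open>sqrt n\<close> lie between
      \<open>sqrt Z\<close> and \<open>sqrt Z + c * X powr \<theta>\<close>. The bound
      \<open>c \<le> C / 2\<close> controls their distance, and \<open>c \<le> 1 / 4\<close> their
      ratio.\<close>
    have "c * X powr \<theta> \<le> 1 / 4 * sqrt X" using Xs c X by (intro mult_mono) auto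
    moreover have "c * X powr \<theta> \<le> C / 2 * X powr \<theta>" using c by (intro mult_right_mono) auto
    ultimately have "\<bar>g * q - sqrt n\<bar> \<le> C / 2 * X powr \<theta>" "sqrt n \<le> 2 * (g * q)"
      using s1 s2 a sXZ by linarith+
    then have "almost_square \<theta> C n"
      using xX nx X by (intro almost_squareI[OF n _ _ \<theta>(1) C, of X]) simp_all
    moreover have "n \<le> x + x powr (1 - 2 * \<theta>) * ln x powr (5 + \<epsilon>)"
      using nx l[OF xX(1)] by linarith
    ultimately show False using x nx by (auto simp: exceptional_set_def)
  qed
  ultimately have "y \<in> Bad" unfolding Bad_def by auto
  with y show "x \<in> (\<Union>y\<in>Bad. {g * y..g * (y + 1)})" by force
qed

section \<open>Measurability and covering by cells of length \<open>g\<close>\<close>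

text \<open>Removing from \<open>{X..2*X}\<close>, for each of the countably many almost squares
  \<open>n\<close>, the Borel set of those \<open>x\<close> whose interval contains \<open>n\<close>
  leaves exactly this set.\<close>

lemma sets_exceptional_set: "exceptional_set \<theta> C \<epsilon> X \<in> sets lebesgue"
proof -
  have "exceptional_set \<theta> C \<epsilon> X = {X..2*X} - (\<Union>n\<in>{n. almost_square \<theta> C n}.
      {x. x \<le> real_of_int n \<and> real_of_int n \<le> x + x powr (1 - 2 * \<theta>) * ln x powr (5 + \<epsilon>)})"
    by (auto simp: exceptional_set_def)
  also have "\<dots> \<in> sets borel"
  proof (intro sets.Diff sets.countable_UN'' countableI_type)
    fix n :: int
    have "(\<lambda>x. x + x powr (1 - 2 * \<theta>) * ln x powr (5 + \<epsilon>)) \<in> borel_measurable borel"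
      by measurable
    then have "{x \<in> space borel. real_of_int n \<le> x + x powr (1 - 2 * \<theta>) * ln x powr (5 + \<epsilon>)} \<in> sets borel"
      by (intro borel_measurable_le borel_measurable_const)
    then have "{..real_of_int n} \<inter> {x. real_of_int n \<le> x + x powr (1 - 2 * \<theta>) * ln x powr (5 + \<epsilon>)} \<in> sets borel"
      by (intro sets.Int) simp_all
    then show "{x. x \<le> real_of_int n \<and> real_of_int n \<le> x + x powr (1 - 2 * \<theta>) * ln x powr (5 + \<epsilon>)} \<in> sets borel"
      by (simp add: Int_def)
  qed simp
  finally show ?thesis using sets_completionI_sets[of _ lborel] by simp
qed

lemma lmeasurable_exceptional_set: "exceptional_set \<theta> C \<epsilon> X \<in> lmeasurable"
  by (rule bounded_set_imp_lmeasurable[OF bounded_subset[of "{X..2*X}"] sets_exceptional_set])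
    (auto simp: exceptional_set_def)

lemma measure_Union_intervals_le:
  fixes g :: int
  assumes "finite Y" "g > 0" "A \<in> lmeasurable" "A \<subseteq> (\<Union>y\<in>Y. {real_of_int (g * y)..real_of_int (g * (y + 1))})"
  shows "measure lebesgue A \<le> g * card Y"
proof -
  have "measure lebesgue A \<le> measure lebesgue (\<Union>y\<in>Y. {real_of_int (g * y)..real_of_int (g * (y + 1))})"
    using assms by (intro measure_mono_fmeasurable fmeasurable.finite_UN) auto
  also have "\<dots> \<le> (\<Sum>y\<in>Y. measure lebesgue {real_of_int (g * y)..real_of_int (g * (y + 1))})"
    using assms by (intro measure_UNION_le) auto
  also have "\<dots> = (\<Sum>y\<in>Y. real_of_int g)"
    using assms by (intro sum.cong) (auto simp: algebra_simps)
  finally show ?thesis by (simp add: mult.commute)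
qed

section \<open>The estimate on one block\<close>

text \<open>The Chebyshev bound is applied with \<open>R\<close> moduli starting near
  \<open>sqrt Z / g\<close>. Of the two error terms, the first is \<open>3 * \<delta>\<close>, from
  the finite length of the range of \<open>y\<close>; the second comes from the gcd sum, of relative
  size \<open>\<Lambda> / E\<close> with \<open>E\<close> at least of order
  \<open>\<Lambda> ^ 4\<close>.\<close>

lemma measure_exceptional_block_le:
  fixes X Z c \<theta> \<epsilon> C L \<Lambda> :: real and g :: int
  defines "\<Lambda> \<equiv> ln X" and "T \<equiv> c * sqrt X * X powr \<theta>"
    and "L \<equiv> X powr (1 - 2 * \<theta>) * ln X powr (5 + \<epsilon>)"
  assumes X: "X \<ge> 1" "X \<le> Z" "Z \<le> 2 * X" and \<theta>: "0 \<le> \<theta>" "\<theta> \<le> 1/2"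
    and C: "C > 0" and \<epsilon>: "\<epsilon> > 0"
    and c: "0 < c" "c \<le> C / 2" "c \<le> 1 / 4"
    and g: "\<Lambda> * sqrt X \<le> g * X powr \<theta>" "g * X powr \<theta> \<le> 2 * \<Lambda> * sqrt X"
    and large: "2 * g \<le> c * X powr \<theta>" "g \<le> L" "L \<le> T" "4 \<le> c * \<Lambda>"
  shows "measure lebesgue (exceptional_set \<theta> C \<epsilon> X \<inter> {Z..Z+T})
           \<le> 2 * T * (12 / (c * \<Lambda>) + 64 * (5 + 4 * \<Lambda>) / (c * \<Lambda> ^ 4))"
proof -
  define w s z where "w = sqrt X" and "s = X powr \<theta>" and "z = sqrt Z"
  have w: "w \<ge> 1" "w\<^sup>2 = X" unfolding w_def using X by auto
  have "1 \<le> c * \<Lambda>" using large by linarith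
  moreover have "c * \<Lambda> \<le> \<Lambda>" if "\<Lambda> \<ge> 0" using that c by (intro mult_left_le_one_le) auto
  ultimately have \<Lambda>: "\<Lambda> \<ge> 1" unfolding \<Lambda>_def using X by (meson ln_ge_zero order_trans)
  have "X powr \<theta> \<le> X powr (1/2)" using X \<theta> by (intro powr_mono) auto
  then have s: "0 < s" "s \<le> w" unfolding s_def w_def using X by (auto simp: powr_half_sqrt)
  have g': "\<Lambda> * w \<le> g * s" "g * s \<le> 2 * \<Lambda> * w" "2 * g \<le> c * s"
    using g large unfolding w_def s_def by auto
  have "\<Lambda> * w > 0" using w \<Lambda> by simp
  then have "real_of_int g * s > 0" using g'(1) by linarith
  then have gpos: "g > 0" using s by (simp add: zero_less_mult_iff)
  have z: "w \<le> z" "z \<le> 3 / 2 * w"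
  proof -
    show "w \<le> z" unfolding w_def z_def using X by simp
    have "Z \<le> (3 / 2 * w)\<^sup>2" using X w by (simp add: power_mult_distrib power2_eq_square)
    then show "z \<le> 3 / 2 * w" unfolding z_def using w by (intro real_le_lsqrt) auto
  qed
  have T: "T = c * w * s" unfolding T_def w_def s_def ..
  have Tpos: "T > 0" using T c w s by simp
  have "c * s \<le> 1 / 4 * w" using c s w by (intro mult_mono) auto
  then have csw: "c * s \<le> w / 4" by simp
  \<comment> \<open>The multiples \<open>g * q\<close> fill the window of length
    \<open>c * s\<close> above \<open>z\<close>, and \<open>g * l\<close> fits into the interval
    length \<open>L\<close>. The extra 1 in \<open>M\<close> is there because \<open>Z\<close> need
    not be a multiple of \<open>g\<close>.\<close>
  define B where "B = \<lceil>z / g\<rceil>"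
  define R where "R = nat \<lfloor>c * s / g\<rfloor>"
  define l where "l = nat \<lfloor>L / g\<rfloor>"
  define M where "M = \<lceil>T / g\<rceil> + 1"
  \<comment> \<open>From \<open>g * q \<le> 2 * w\<close> one gets
    \<open>g^2 * q * r \<le> 4 * w^2\<close>. As \<open>\<Lambda> * w \<le> g * s\<close> and
    \<open>T = c * w * s\<close>, this is at most
    \<open>4 / (c * \<Lambda>) * T * g\<close>.\<close>
  define \<delta> where "\<delta> = 4 / (c * \<Lambda>)"
  define S where "S = {B..<B + int R}"
  define E where "E = (\<Sum>q\<in>S. real l / real_of_int q)"
  define Bad where "Bad = {y \<in> {\<lfloor>Z / g\<rfloor>..<\<lfloor>Z / g\<rfloor> + M}. \<forall>q\<in>S. \<forall>i\<in>{1..int l}. \<not> q dvd y + i}"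
  define G where "G = (\<Sum>q\<in>S. \<Sum>r\<in>S. real_of_int (gcd q r) / real_of_int (q * r))"

  have "z / g \<le> B" "B < z / g + 1" unfolding B_def by linarith+
  then have B: "z \<le> g * B" "g * B < z + g" using gpos by (simp_all add: field_simps)
  \<comment> \<open>Rounding down a number that is at least 1 loses at most a factor 2; this is used
    for \<open>R\<close> and for \<open>l\<close>.\<close>
  have "c * s / g \<ge> 2" using g' gpos by (simp add: field_simps)
  then have "R \<le> c * s / g" "c * s / g \<le> 2 * R" "R \<ge> 1" unfolding R_def by linarith+
  then have R: "g * R \<le> c * s" "c * s \<le> 2 * (g * R)" "R > 0" using gpos by (simp_all add: field_simps)
  have "L / g \<ge> 1" using large gpos by (simp add: field_simps)
  then have "\<lfloor>L / g\<rfloor> \<ge> 1" by simp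
  then have "l \<le> L / g" "L / g \<le> 2 * real l" unfolding l_def by linarith+
  then have l: "g * l \<le> L" "L \<le> 2 * (g * l)" using gpos by (simp_all add: field_simps)
  have "T / g + 1 \<le> M" "M \<le> T / g + 2" unfolding M_def by linarith+
  moreover have "2 * g \<le> T"
  proof -
    have "c * s * 1 \<le> c * s * w" using c s w by (intro mult_left_mono) auto
    then show ?thesis using g' T by (simp add: mult_ac)
  qed
  ultimately have M: "T / g + 1 \<le> M" "T \<le> g * M" "g * M \<le> 2 * T"
    using gpos by (simp_all add: field_simps)
  then have "real_of_int (g * M) > 0" using Tpos by linarith
  then have Mpos: "M > 0" using gpos by (simp add: zero_less_mult_iff)
  have "real_of_int (g * B) > 0" using B z w by linarith
  then have Bpos: "B > 0" using gpos by (simp add: zero_less_mult_iff)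
  have q: "0 < q" "g * q \<le> 2 * w" if "q \<in> S" for q
  proof -
    show "0 < q" using that Bpos S_def by auto
    have "g * q \<le> g * (B + R)" using that gpos unfolding S_def by (intro mult_left_mono) auto
    then have "real_of_int (g * q) \<le> real_of_int (g * (B + R))" by (simp only: of_int_le_iff)
    also have "\<dots> = g * B + g * R" by (simp add: distrib_left)
    \<comment> \<open>The three contributions are \<open>z \<le> 3 / 2 * w\<close>,
      \<open>g \<le> w / 8\<close> and \<open>g * R \<le> w / 4\<close>.\<close>
    also have "\<dots> \<le> 2 * w" using B R z csw g' by linarith
    finally show "g * q \<le> 2 * w" by simp
  qed
  have Lx: "g * l \<le> x powr (1 - 2 * \<theta>) * ln x powr (5 + \<epsilon>)" if "x \<ge> X" for x
  proof -
    have "L \<le> x powr (1 - 2 * \<theta>) * ln x powr (5 + \<epsilon>)" unfolding L_def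
      using that X \<theta> \<epsilon> by (intro mult_mono powr_mono2) auto
    then show ?thesis using l by linarith
  qed

  \<comment> \<open>The largest modulus is \<open>B + R - 1\<close>; its missing 1 compensates the
    rounding up in \<open>B\<close>.\<close>
  have "g * (B + R - 1) = (g * B - g) + g * R" by (simp add: algebra_simps)
  then have "real_of_int (g * (B + R - 1)) = (g * B - g) + g * R" by (metis of_int_add of_int_diff of_int_mult of_int_of_nat_eq)
  then have "g * (B + R - 1) \<le> z + c * s" using B R by linarith
  moreover have "T + g * l \<le> 2 * c * w * s" using l large T by linarith
  ultimately have "exceptional_set \<theta> C \<epsilon> X \<inter> {Z..Z+T} \<subseteq> (\<Union>y\<in>Bad. {g * y..g * (y + 1)})"
    unfolding Bad_def S_def using X \<theta> C c gpos M B Lx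
    by (intro exceptional_set_block_subset[where c = c]) (auto simp: w_def s_def z_def)
  moreover have "finite Bad" unfolding Bad_def by (rule finite_subset[of _ "{\<lfloor>Z / g\<rfloor>..<\<lfloor>Z / g\<rfloor> + M}"]) auto
  ultimately have meas: "measure lebesgue (exceptional_set \<theta> C \<epsilon> X \<inter> {Z..Z+T}) \<le> g * card Bad"
    using gpos by (intro measure_Union_intervals_le fmeasurable.Int lmeasurable_exceptional_set) auto

  have \<delta>: "0 \<le> \<delta>" "\<delta> \<le> 1" unfolding \<delta>_def using large \<Lambda> c by (simp_all add: field_simps)
  have qr: "q * r \<le> \<delta> * M" if "q \<in> S" "r \<in> S" for q r
  proof -
    have "real_of_int (g * q) * real_of_int (g * r) \<le> (2 * w) * (2 * w)"
      using q[OF that(1)] q[OF that(2)] w gpos by (intro mult_mono) auto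
    also have "\<dots> = 4 / \<Lambda> * w * (\<Lambda> * w)" using \<Lambda> by simp
    also have "\<dots> \<le> 4 / \<Lambda> * w * (g * s)" using g' \<Lambda> w by (intro mult_left_mono) auto
    also have "\<dots> = \<delta> * T * g" unfolding \<delta>_def T using c \<Lambda> by simp
    also have "\<dots> \<le> \<delta> * (g * M) * g" using M \<delta> gpos by (intro mult_left_mono mult_right_mono) auto
    finally have "(real_of_int g)\<^sup>2 * (q * r) \<le> (real_of_int g)\<^sup>2 * (\<delta> * M)"
      by (simp add: power2_eq_square mult_ac)
    then show ?thesis using gpos by simp
  qed
  have main: "card Bad * E\<^sup>2 \<le> M * (3 * \<delta> * E\<^sup>2 + 2 * l * G)"
    unfolding Bad_def E_def G_def using q qr \<delta> Mpos
    by (intro card_no_hits_le) (auto simp: S_def)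

  have E_ge: "E \<ge> R * l * g / (2 * w)"
  proof -
    have "(\<Sum>q\<in>S. l * g / (2 * w)) \<le> E" unfolding E_def
    proof (rule sum_mono)
      fix q' assume "q' \<in> S"
      from q[OF this] have "l * (g * q') \<le> l * (2 * w)" "q' > 0" by (auto intro!: mult_left_mono)
      then show "l * g / (2 * w) \<le> real l / real_of_int q'" using w by (simp add: field_simps)
    qed
    then show ?thesis by (simp add: S_def mult_ac)
  qed
  \<comment> \<open>Since \<open>1 / B \<le> g / w\<close> and \<open>R * g / w \<le> 1\<close>, the
    gcd sum is at most \<open>R * g / w\<close> times \<open>5 + 4 * \<Lambda>\<close>. The factor
    \<open>l * R * g / w\<close> is at most \<open>2 * E\<close>, so dividing by \<open>E^2\<close>
    later leaves \<open>\<Lambda> / E\<close>.\<close>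
  have LG: "l * G \<le> 2 * E * (5 + 4 * \<Lambda>)"
  proof -
    have "R \<le> X"
    proof -
      have "real R * 1 \<le> R * real_of_int g" using gpos by (intro mult_left_mono) auto
      also have "\<dots> \<le> w" using R csw w by (simp add: mult_ac)
      also have "\<dots> \<le> w * w" using w by simp
      finally show ?thesis using w by (simp add: power2_eq_square)
    qed
    then have lnR: "ln R \<le> \<Lambda>" unfolding \<Lambda>_def using R by simp
    have Bw: "1 / B \<le> g / w" using B z w Bpos by (simp add: field_simps)
    have Rgw: "R * (g / w) \<le> 1" using R csw w by (simp add: field_simps)
    have "G \<le> R / B + 4 * R\<^sup>2 * (1 + ln R) / B\<^sup>2"
      unfolding G_def S_def by (rule sum_gcd_le[OF Bpos R(3)])
    also have "\<dots> = R * (1 / B) * (1 + 4 * (R * (1 / B)) * (1 + ln R))"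
      using Bpos by (simp add: field_simps power2_eq_square)
    also have "\<dots> \<le> R * (g / w) * (1 + 4 * (R * (g / w)) * (1 + \<Lambda>))"
      using R gpos w Bpos \<Lambda> by (intro mult_mono add_mono Bw lnR) auto
    also have "\<dots> \<le> R * (g / w) * (1 + 4 * 1 * (1 + \<Lambda>))"
      using R gpos w Rgw \<Lambda> by (intro mult_left_mono add_mono mult_right_mono) auto
    finally have "l * G \<le> l * (R * (g / w) * (5 + 4 * \<Lambda>))"
      by (intro mult_left_mono) auto
    also have "\<dots> = 2 * (R * l * g / (2 * w)) * (5 + 4 * \<Lambda>)" by (simp add: field_simps)
    also have "\<dots> \<le> 2 * E * (5 + 4 * \<Lambda>)" using E_ge \<Lambda> by (intro mult_right_mono mult_left_mono) auto
    finally show ?thesis .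
  qed
  \<comment> \<open>The length \<open>L\<close> supplies \<open>\<Lambda> ^ 5\<close>, and the
    factor \<open>\<Lambda>\<close> in \<open>g\<close> takes one power back. The 16 collects 4 from
    rounding \<open>R\<close> and \<open>l\<close>, 2 from
    \<open>g * s \<le> 2 * \<Lambda> * w\<close>, and 2 from \<open>E_ge\<close>.\<close>
  have E_big: "E \<ge> c * \<Lambda> ^ 4 / 16"
  proof -
    have Lss: "L * s * s = w\<^sup>2 * \<Lambda> powr (5 + \<epsilon>)"
    proof -
      have "X powr (1 - 2 * \<theta>) * X powr \<theta> * X powr \<theta> = X"
        using X by (simp flip: powr_add)
      then show ?thesis unfolding L_def s_def \<Lambda>_def w(2) by (simp add: mult_ac)
    qed
    have "\<Lambda> ^ 5 = \<Lambda> powr 5" using \<Lambda> by simp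
    also have "\<dots> \<le> \<Lambda> powr (5 + \<epsilon>)" using \<Lambda> \<epsilon> by (intro powr_mono) auto
    finally have "w\<^sup>2 * \<Lambda> ^ 5 \<le> L * s * s" unfolding Lss by (intro mult_left_mono) auto
    then have "c * w\<^sup>2 * \<Lambda> ^ 5 \<le> c * (L * s * s)" using c by (simp add: mult.assoc)
    also have "\<dots> = (c * s) * L * s" by simp
    also have "\<dots> \<le> (2 * real_of_int (g * R)) * (2 * real_of_int (g * l)) * s"
    proof (rule mult_right_mono)
      show "c * s * L \<le> (2 * real_of_int (g * R)) * (2 * real_of_int (g * l))"
        by (rule mult_mono) (use R l c s gpos large in auto)
    qed (use s in simp)
    also have "\<dots> = (4 * R * l * g) * (g * s)" by simp
    also have "\<dots> \<le> (4 * R * l * g) * (2 * \<Lambda> * w)"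
      using g' gpos by (intro mult_left_mono) auto
    also have "\<dots> = 16 * w\<^sup>2 * \<Lambda> * (R * l * g / (2 * w))"
      using w by (simp add: field_simps power2_eq_square)
    also have "\<dots> \<le> 16 * w\<^sup>2 * \<Lambda> * E" using E_ge \<Lambda> by (intro mult_left_mono) auto
    finally have "(w\<^sup>2 * \<Lambda>) * (c * \<Lambda> ^ 4) \<le> (w\<^sup>2 * \<Lambda>) * (16 * E)"
      by (simp add: eval_nat_numeral mult_ac)
    moreover have "w\<^sup>2 * \<Lambda> > 0" using w(1) \<Lambda> by simp
    ultimately have "c * \<Lambda> ^ 4 \<le> 16 * E" by (simp only: mult_le_cancel_left_pos)
    then show ?thesis by simp
  qed
  moreover have "c * \<Lambda> ^ 4 / 16 > 0" using c \<Lambda> by simp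
  ultimately have Epos: "E > 0" by linarith
  note main
  also have "M * (3 * \<delta> * E\<^sup>2 + 2 * l * G) \<le> M * (3 * \<delta> * E\<^sup>2 + 2 * (2 * E * (5 + 4 * \<Lambda>)))"
  proof (rule mult_left_mono)
    have "2 * (l * G) \<le> 2 * (2 * E * (5 + 4 * \<Lambda>))" using LG by (intro mult_left_mono) auto
    then show "3 * \<delta> * E\<^sup>2 + 2 * l * G \<le> 3 * \<delta> * E\<^sup>2 + 2 * (2 * E * (5 + 4 * \<Lambda>))"
      by (simp add: mult_ac)
  qed (use Mpos in simp)
  also have "\<dots> = (M * (3 * \<delta> + 4 * (5 + 4 * \<Lambda>) / E)) * E\<^sup>2"
    using Epos by (simp add: field_simps power2_eq_square)
  finally have "card Bad \<le> M * (3 * \<delta> + 4 * (5 + 4 * \<Lambda>) / E)" using Epos by simp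
  also have "\<dots> \<le> M * (3 * \<delta> + 4 * (5 + 4 * \<Lambda>) / (c * \<Lambda> ^ 4 / 16))"
    using Mpos \<Lambda> c E_big Epos by (intro mult_left_mono add_left_mono divide_left_mono) auto
  also have "\<dots> = M * (12 / (c * \<Lambda>) + 64 * (5 + 4 * \<Lambda>) / (c * \<Lambda> ^ 4))"
    unfolding \<delta>_def by simp
  finally have "g * card Bad \<le> g * M * (12 / (c * \<Lambda>) + 64 * (5 + 4 * \<Lambda>) / (c * \<Lambda> ^ 4))"
    using gpos by (simp add: mult.assoc mult_left_mono)
  also have "\<dots> \<le> 2 * T * (12 / (c * \<Lambda>) + 64 * (5 + 4 * \<Lambda>) / (c * \<Lambda> ^ 4))"
    using M c \<Lambda> by (intro mult_right_mono) auto
  finally show ?thesis using meas by linarith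
qed

section \<open>From blocks to the whole of \<open>[X, 2X]\<close>\<close>

text \<open>The interval is covered by \<open>\<lfloor>X / T\<rfloor> + 1\<close> consecutive
  blocks, at most \<open>2 * X / T\<close> of them because \<open>T \<le> X\<close>. The last block
  may run past \<open>2 * X\<close>.\<close>

lemma measure_le_of_blocks:
  fixes X T W :: real
  assumes A: "A \<in> lmeasurable" "A \<subseteq> {X..2*X}" and T: "0 < T" "T \<le> X"
    and W: "\<And>Z. X \<le> Z \<Longrightarrow> Z \<le> 2 * X \<Longrightarrow> measure lebesgue (A \<inter> {Z..Z+T}) \<le> T * W"
  shows "measure lebesgue A \<le> 2 * X * W"
proof -
  define n where "n = nat \<lfloor>X / T\<rfloor>"
  have n: "X / T < real n + 1" "n \<le> X / T" unfolding n_def using T by simp_all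
  have "A \<subseteq> (\<Union>k\<in>{..n}. A \<inter> {X + k * T..X + k * T + T})"
  proof
    fix x assume x: "x \<in> A"
    define k where "k = nat \<lfloor>(x - X) / T\<rfloor>"
    have xX: "X \<le> x" "x \<le> 2 * X" using x A by auto
    then have "(x - X) / T \<ge> 0" using T by simp
    then have k: "k \<le> (x - X) / T" "(x - X) / T < real k + 1" unfolding k_def by linarith+
    have "(x - X) / T \<le> X / T" using xX T by (intro divide_right_mono) auto
    then have "k \<le> n" using k n by linarith
    moreover have "x \<in> {X + k * T..X + k * T + T}" using k T by (simp add: field_simps)
    ultimately show "x \<in> (\<Union>k\<in>{..n}. A \<inter> {X + k * T..X + k * T + T})" using x by blast
  qed
  then have "measure lebesgue A \<le> measure lebesgue (\<Union>k\<in>{..n}. A \<inter> {X + k * T..X + k * T + T})"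
    using A by (intro measure_mono_fmeasurable fmeasurable.finite_UN fmeasurable.Int) auto
  also have "\<dots> \<le> (\<Sum>k\<in>{..n}. measure lebesgue (A \<inter> {X + k * T..X + k * T + T}))"
    using A by (intro measure_UNION_le sets.Int) auto
  also have "\<dots> \<le> (\<Sum>k\<in>{..n}. T * W)"
  proof (intro sum_mono W)
    fix k assume "k \<in> {..n}"
    then have "k \<le> X / T" using n by simp
    then show "X \<le> X + k * T" "X + k * T \<le> 2 * X" using T by (simp_all add: field_simps)
  qed
  also have "\<dots> = (real n + 1) * (T * W)" by simp
  also have "\<dots> \<le> (2 * X / T) * (T * W)"
  proof (intro mult_right_mono)
    have "1 \<le> X / T" using T by simp
    then show "real n + 1 \<le> 2 * X / T" using n by simp
    \<comment> \<open>The sign of \<open>W\<close> is not assumed; it follows from the block bound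
      at \<open>Z = X\<close>.\<close>
    have "0 \<le> measure lebesgue (A \<inter> {X..X+T})" by simp
    also have "\<dots> \<le> T * W" using T by (intro W) auto
    finally show "0 \<le> T * W" .
  qed
  also have "\<dots> = 2 * X * W" using T by simp
  finally show ?thesis .
qed

section \<open>Choice of \<open>g\<close> and passage to the limit\<close>

text \<open>Fixes \<open>g\<close> once for all blocks. The conditions \<open>large\<close> isolate
  everything that has to hold for large \<open>X\<close>.\<close>

lemma measure_exceptional_set_le:
  fixes X c \<theta> \<epsilon> C :: real
  assumes \<theta>: "0 \<le> \<theta>" "\<theta> \<le> 1/2" and C: "C > 0" and \<epsilon>: "\<epsilon> > 0"
    and c: "0 < c" "c \<le> C / 2" "c \<le> 1 / 4" and X: "X \<ge> 1"
    and large: "1 \<le> ln X * X powr (1/2 - \<theta>)"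
      "4 * (ln X * X powr (1/2 - \<theta>)) \<le> c * X powr \<theta>"
      "2 * (ln X * X powr (1/2 - \<theta>)) \<le> X powr (1 - 2 * \<theta>) * ln X powr (5 + \<epsilon>)"
      "X powr (1 - 2 * \<theta>) * ln X powr (5 + \<epsilon>) \<le> c * X powr (1/2) * X powr \<theta>"
      "4 \<le> c * ln X"
  shows "measure lebesgue (exceptional_set \<theta> C \<epsilon> X)
           \<le> 4 * X * (12 / (c * ln X) + 64 * (5 + 4 * ln X) / (c * ln X ^ 4))"
proof -
  define T where "T = c * sqrt X * X powr \<theta>"
  define K where "K = ln X * X powr (1/2 - \<theta>)"
  define g where "g = \<lceil>K\<rceil>"
  have "K \<ge> 1" unfolding K_def by (rule large)
  \<comment> \<open>Because \<open>K \<ge> 1\<close>, rounding up at most doubles it.\<close>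
  then have g: "K \<le> g" "g \<le> 2 * K" unfolding g_def by linarith+
  have half: "X powr (1/2) = sqrt X" using X by (simp add: powr_half_sqrt)
  have Xp: "X powr (1/2 - \<theta>) * X powr \<theta> = sqrt X"
    using X by (simp flip: powr_add half)
  then have K: "K * X powr \<theta> = ln X * sqrt X" unfolding K_def by (simp add: mult.assoc)
  have "K * X powr \<theta> \<le> g * X powr \<theta>" "g * X powr \<theta> \<le> 2 * K * X powr \<theta>"
    using g by (auto intro!: mult_right_mono)
  then have gX: "ln X * sqrt X \<le> g * X powr \<theta>" "g * X powr \<theta> \<le> 2 * ln X * sqrt X"
    using K by simp_all
  have gL: "2 * g \<le> c * X powr \<theta>" "g \<le> X powr (1 - 2 * \<theta>) * ln X powr (5 + \<epsilon>)"
    using g large unfolding K_def by linarith+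
  have "X powr \<theta> \<le> X powr (1/2)" using X \<theta> by (intro powr_mono) auto
  then have "c * sqrt X * X powr \<theta> \<le> 1 * sqrt X * sqrt X"
    using c X half by (intro mult_mono) auto
  then have T: "0 < T" "T \<le> X" unfolding T_def using c X by simp_all
  have "measure lebesgue (exceptional_set \<theta> C \<epsilon> X)
      \<le> 2 * X * (2 * (12 / (c * ln X) + 64 * (5 + 4 * ln X) / (c * ln X ^ 4)))"
  proof (rule measure_le_of_blocks[OF lmeasurable_exceptional_set _ T])
    show "exceptional_set \<theta> C \<epsilon> X \<subseteq> {X..2 * X}" by (auto simp: exceptional_set_def)
    fix Z assume Z: "X \<le> Z" "Z \<le> 2 * X"
    have "X powr (1 - 2 * \<theta>) * ln X powr (5 + \<epsilon>) \<le> c * sqrt X * X powr \<theta>"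
      using large(4) half by simp
    from measure_exceptional_block_le[OF X Z \<theta> C \<epsilon> c gX gL this large(5)]
    show "measure lebesgue (exceptional_set \<theta> C \<epsilon> X \<inter> {Z..Z + T})
        \<le> T * (2 * (12 / (c * ln X) + 64 * (5 + 4 * ln X) / (c * ln X ^ 4)))"
      unfolding T_def by (simp only: mult_ac)
  qed
  moreover have "2 * X * (2 * Y) = 4 * X * Y" for Y by simp
  ultimately show ?thesis by metis
qed

theorem theorem1:
  fixes \<theta> \<epsilon> C :: real
  assumes "1/4 < \<theta>" and "\<theta> \<le> 1/2" and "\<epsilon> > 0" and "C > 0"
  shows "(\<forall>X>0. exceptional_set \<theta> C \<epsilon> X \<in> sets lebesgue) \<and>
         ((\<lambda>X. measure lebesgue (exceptional_set \<theta> C \<epsilon> X) / X) \<longlongrightarrow> 0) at_top"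
proof (intro conjI allI impI sets_exceptional_set)
  define c where "c = min (C / 2) (1 / 4)"
  have c: "0 < c" "c \<le> C / 2" "c \<le> 1 / 4" using assms unfolding c_def by auto
  define \<eta> where "\<eta> = (\<lambda>X. 4 * (12 / (c * ln X) + 64 * (5 + 4 * ln X) / (c * ln X ^ 4)))"
  \<comment> \<open>At \<open>\<theta> = 1/2\<close> the power of \<open>X\<close> is constant and
    only the logarithm grows, hence the case split.\<close>
  have "\<forall>\<^sub>F X in at_top. 1 \<le> ln X * X powr (1/2 - \<theta>)"
  proof (cases "\<theta> = 1/2")
    case True
    have "\<forall>\<^sub>F X :: real in at_top. 1 \<le> ln X \<and> X > 0"
      by (intro eventually_conj) real_asymp+
    then show ?thesis by eventually_elim (simp add: True)
  next
    case False
    then have "1/2 - \<theta> > 0" using assms by simp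
    then show ?thesis by real_asymp
  qed
  \<comment> \<open>Here \<open>\<theta> > 1/4\<close> is essential: it says
    \<open>1/2 - \<theta> < \<theta>\<close>, so the window for \<open>g * q\<close> contains many
    multiples of \<open>g\<close>.\<close>
  moreover have "\<forall>\<^sub>F X in at_top. 4 * (ln X * X powr (1/2 - \<theta>)) \<le> c * X powr \<theta>"
    using assms c by real_asymp
  moreover have "\<forall>\<^sub>F X in at_top. 2 * (ln X * X powr (1/2 - \<theta>)) \<le> X powr (1 - 2 * \<theta>) * ln X powr (5 + \<epsilon>)"
  proof (cases "\<theta> = 1/2")
    case True
    have "\<forall>\<^sub>F X :: real in at_top. 2 * ln X \<le> ln X powr (5 + \<epsilon>) \<and> X > 0"
      using assms by (intro eventually_conj) real_asymp+
    then show ?thesis by eventually_elim (simp add: True)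
  next
    case False
    then have "1/2 - \<theta> > 0" "1 - 2 * \<theta> > 1/2 - \<theta>" using assms by simp_all
    then show ?thesis using assms by real_asymp
  qed
  moreover have "\<forall>\<^sub>F X in at_top. X powr (1 - 2 * \<theta>) * ln X powr (5 + \<epsilon>) \<le> c * X powr (1/2) * X powr \<theta>"
    using assms c by real_asymp
  moreover have "\<forall>\<^sub>F X in at_top. 4 \<le> c * ln X" using c by real_asymp
  moreover have "\<forall>\<^sub>F X in at_top. (1 :: real) \<le> X" by (rule eventually_ge_at_top)
  ultimately have upper: "\<forall>\<^sub>F X in at_top. measure lebesgue (exceptional_set \<theta> C \<epsilon> X) / X \<le> \<eta> X"
  proof eventually_elim
    case (elim X)
    then show ?case
      using measure_exceptional_set_le[of \<theta> C \<epsilon> c X] assms c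
      by (simp add: \<eta>_def divide_le_eq mult_ac)
  qed
  have lower: "\<forall>\<^sub>F X in at_top. 0 \<le> measure lebesgue (exceptional_set \<theta> C \<epsilon> X) / X"
    using eventually_gt_at_top[of 0] by eventually_elim simp
  \<comment> \<open>The two terms of \<open>\<eta>\<close> are of order \<open>1 / ln X\<close> and
    \<open>1 / ln X ^ 3\<close>.\<close>
  have "(\<eta> \<longlongrightarrow> 0) at_top" unfolding \<eta>_def using c by real_asymp
  then show "((\<lambda>X. measure lebesgue (exceptional_set \<theta> C \<epsilon> X) / X) \<longlongrightarrow> 0) at_top"
    by (rule tendsto_sandwich[OF lower upper tendsto_const])
qed

end
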